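(* Let $F=\alpha e^{\beta/\alpha}$ be a $G$-invariant exponential metric on $G/H$. Then $\alpha$ is a $G$-invariant Riemannian metric and the vector field $X$ corresponding to the 1-form $\beta$ is a $G$-invariant vector field.
   Context: A Finsler metric on a connected smooth manifold $M$ is a function $F:TM\to[0,\infty)$, smooth on $TM\setminus\{0\}$, whose restriction to each $T_xM$ is a Minkowski norm, i.e. $F$ is positively homogeneous of degree one in $y$ and the Hessian $\frac12(F^2)_{y^iy^j}$ is positive definite for $y\neq0$. The exponential metric is the Finsler metric $F=\alpha e^{\beta/\alpha}$, where $\alpha(x,y)=\sqrt{a_{ij}(x)y^iy^j}$ is (the norm of) a Riemannian metric and $\beta=b_i(x)y^i$ is a 1-form. $X$ is the vector field dual to $\beta$ with respect to $\alpha$: $\langle X|_x,y\rangle=\beta(y)$ for all $y\in T_xM$, i.e. $X=b^i\partial/\partial x^i$ with $b^i=a^{ij}b_j$. $G$ is a Lie group and $H$ a compact (isotropy) subgroup, $G/H$ is a connected coset space which is reductive: $\mathfrak g=\mathfrak h\oplus\mathfrak m$ with $\mathrm{Ad}(h)\mathfrak m\subset\mathfrak m$ for all $h\in H$ (where $\mathfrak g,\mathfrak h$ are the Lie algebras of $G,H$). A Finsler metric, Riemannian metric or vector field on $G/H$ is $G$-invariant if it is preserved by the natural left action of $G$. *)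

theory Defs
  imports "HOL-Analysis.Analysis" "HOL-Algebra.Left_Coset"
begin

section \<open>Smooth maps between Euclidean spaces\<close>

text \<open>\<open>Ck_on k S f\<close> is used for open \<open>S\<close> only.\<close>

primrec Ck_on :: "nat \<Rightarrow> 'a::real_normed_vector set \<Rightarrow> ('a \<Rightarrow> 'b::real_normed_vector) \<Rightarrow> bool" where
  "Ck_on 0 S f \<longleftrightarrow> continuous_on S f"
| "Ck_on (Suc k) S f \<longleftrightarrow>
     (\<forall>x\<in>S. f differentiable at x) \<and> (\<forall>v. Ck_on k S (\<lambda>x. frechet_derivative f (at x) v))"

definition smooth_on :: "'a::real_normed_vector set \<Rightarrow> ('a \<Rightarrow> 'b::real_normed_vector) \<Rightarrow> bool" where
  "smooth_on S f \<longleftrightarrow> (\<forall>k. Ck_on k S f)"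


section \<open>Smooth manifolds\<close>

text \<open>A chart is a pair of its domain and a coordinate map, whose values off the domain are
  irrelevant. A manifold carries a smooth atlas that need not be maximal; all notions below depend
  only on the smooth structure that the atlas generates. The underlying set is
  \<open>topspace (mtop M)\<close>.\<close>

type_synonym ('p, 'e) chart = "'p set \<times> ('p \<Rightarrow> 'e)"

record ('p, 'e) manifold =
  mtop :: "'p topology"
  atlas :: "('p, 'e) chart set"

definition chart_inv :: "('p, 'e) chart \<Rightarrow> 'e \<Rightarrow> 'p" where
  "chart_inv c = inv_into (fst c) (snd c)"

definition chart_image :: "('p, 'e) chart \<Rightarrow> 'e set" where
  "chart_image c = snd c ` fst c"

definition charts_at :: "('p, 'e) manifold \<Rightarrow> 'p \<Rightarrow> ('p, 'e) chart set" where
  "charts_at M p = {c \<in> atlas M. p \<in> fst c}"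

definition is_chart :: "'p topology \<Rightarrow> ('p, 'e::euclidean_space) chart \<Rightarrow> bool" where
  "is_chart T c \<longleftrightarrow> openin T (fst c) \<and> open (chart_image c) \<and>
     homeomorphic_map (subtopology T (fst c)) (top_of_set (chart_image c)) (snd c)"

definition smooth_manifold :: "('p, 'e::euclidean_space) manifold \<Rightarrow> bool" where
  "smooth_manifold M \<longleftrightarrow>
     Hausdorff_space (mtop M) \<and> second_countable (mtop M) \<and>
     (\<forall>c\<in>atlas M. is_chart (mtop M) c) \<and>
     (\<forall>p\<in>topspace (mtop M). charts_at M p \<noteq> {}) \<and>
     (\<forall>c\<in>atlas M. \<forall>d\<in>atlas M. smooth_on (snd c ` (fst c \<inter> fst d)) (snd d \<circ> chart_inv c))"

definition smooth_map ::
    "('p, 'e::euclidean_space) manifold \<Rightarrow> ('q, 'f::euclidean_space) manifold \<Rightarrow> ('p \<Rightarrow> 'q) \<Rightarrow> bool" where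
  "smooth_map M N f \<longleftrightarrow> continuous_map (mtop M) (mtop N) f \<and>
     (\<forall>c\<in>atlas M. \<forall>d\<in>atlas N.
        smooth_on (snd c ` {p \<in> fst c. f p \<in> fst d}) (snd d \<circ> f \<circ> chart_inv c))"

definition product_manifold ::
    "('p, 'e) manifold \<Rightarrow> ('q, 'f) manifold \<Rightarrow> ('p \<times> 'q, 'e \<times> 'f) manifold" where
  "product_manifold M N = \<lparr>mtop = prod_topology (mtop M) (mtop N),
     atlas = {(fst c \<times> fst d, map_prod (snd c) (snd d)) |c d. c \<in> atlas M \<and> d \<in> atlas N}\<rparr>"

definition real_line :: "(real, real) manifold" where
  "real_line = \<lparr>mtop = euclideanreal, atlas = {(UNIV, \<lambda>t. t)}\<rparr>"


section \<open>Tangent vectors\<close>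

text \<open>A tangent vector at \<open>p\<close> is the family of its coordinate vectors with respect to the charts
  at \<open>p\<close>, transforming under a change of chart by the derivative of the transition map. The
  vector space operations are pointwise; components at other charts are set to 0, which makes the
  representation unique.\<close>

type_synonym ('p, 'e) tvec = "('p, 'e) chart \<Rightarrow> 'e"

definition tangent_space :: "('p, 'e::euclidean_space) manifold \<Rightarrow> 'p \<Rightarrow> ('p, 'e) tvec set" where
  "tangent_space M p =
     {v. (\<forall>c\<in>charts_at M p. \<forall>d\<in>charts_at M p.
            v d = frechet_derivative (snd d \<circ> chart_inv c) (at (snd c p)) (v c)) \<and>
         (\<forall>c. c \<notin> charts_at M p \<longrightarrow> v c = 0)}"

definition tzero :: "('p, 'e::euclidean_space) tvec" where
  "tzero = (\<lambda>c. 0)"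

definition tadd :: "('p, 'e::euclidean_space) tvec \<Rightarrow> ('p, 'e) tvec \<Rightarrow> ('p, 'e) tvec" where
  "tadd v w = (\<lambda>c. v c + w c)"

definition tscale :: "real \<Rightarrow> ('p, 'e::euclidean_space) tvec \<Rightarrow> ('p, 'e) tvec" where
  "tscale r v = (\<lambda>c. r *\<^sub>R v c)"

text \<open>The tangent vector at \<open>p\<close> with coordinates \<open>y\<close> in the chart \<open>c\<close>, i.e. the sum of
  \<open>y\<^sup>i \<partial>/\<partial>x\<^sup>i\<close>.\<close>

definition coord_vector ::
    "('p, 'e::euclidean_space) manifold \<Rightarrow> ('p, 'e) chart \<Rightarrow> 'p \<Rightarrow> 'e \<Rightarrow> ('p, 'e) tvec" where
  "coord_vector M c p y =
     (\<lambda>d. if d \<in> charts_at M p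
          then frechet_derivative (snd d \<circ> chart_inv c) (at (snd c p)) y else 0)"

text \<open>By the chain rule the differential of a smooth map does not depend on the selected chart.\<close>

definition differential ::
    "('p, 'e::euclidean_space) manifold \<Rightarrow> ('q, 'f::euclidean_space) manifold \<Rightarrow> ('p \<Rightarrow> 'q) \<Rightarrow> 'p \<Rightarrow>
     ('p, 'e) tvec \<Rightarrow> ('q, 'f) tvec" where
  "differential M N f p v =
     (let c = (SOME c. c \<in> charts_at M p) in
      (\<lambda>d. if d \<in> charts_at N (f p)
           then frechet_derivative (snd d \<circ> f \<circ> chart_inv c) (at (snd c p)) (v c) else 0))"

definition velocity ::
    "('p, 'e::euclidean_space) manifold \<Rightarrow> (real \<Rightarrow> 'p) \<Rightarrow> real \<Rightarrow> ('p, 'e) tvec" where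
  "velocity M \<gamma> t =
     (\<lambda>d. if d \<in> charts_at M (\<gamma> t) then vector_derivative (snd d \<circ> \<gamma>) (at t) else 0)"

definition submersion ::
    "('p, 'e::euclidean_space) manifold \<Rightarrow> ('q, 'f::euclidean_space) manifold \<Rightarrow> ('p \<Rightarrow> 'q) \<Rightarrow> bool" where
  "submersion M N f \<longleftrightarrow> smooth_map M N f \<and>
     (\<forall>p\<in>topspace (mtop M). differential M N f p ` tangent_space M p = tangent_space N (f p))"

definition tangent_subspace ::
    "('p, 'e::euclidean_space) manifold \<Rightarrow> 'p \<Rightarrow> ('p, 'e) tvec set \<Rightarrow> bool" where
  "tangent_subspace M p V \<longleftrightarrow> V \<subseteq> tangent_space M p \<and> tzero \<in> V \<and>
     (\<forall>v\<in>V. \<forall>w\<in>V. tadd v w \<in> V) \<and> (\<forall>r. \<forall>v\<in>V. tscale r v \<in> V)"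

definition tangent_linear ::
    "('p, 'e::euclidean_space) manifold \<Rightarrow> 'p \<Rightarrow> (('p, 'e) tvec \<Rightarrow> real) \<Rightarrow> bool" where
  "tangent_linear M p f \<longleftrightarrow>
     (\<forall>v\<in>tangent_space M p. \<forall>w\<in>tangent_space M p. f (tadd v w) = f v + f w) \<and>
     (\<forall>r. \<forall>v\<in>tangent_space M p. f (tscale r v) = r * f v)"


section \<open>Vector fields, 1-forms, Riemannian and Finsler metrics\<close>

definition vector_field ::
    "('p, 'e::euclidean_space) manifold \<Rightarrow> ('p \<Rightarrow> ('p, 'e) tvec) \<Rightarrow> bool" where
  "vector_field M X \<longleftrightarrow>
     (\<forall>p\<in>topspace (mtop M). X p \<in> tangent_space M p) \<and>
     (\<forall>c\<in>atlas M. smooth_on (chart_image c) (\<lambda>x. X (chart_inv c x) c))"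

definition one_form ::
    "('p, 'e::euclidean_space) manifold \<Rightarrow> ('p \<Rightarrow> ('p, 'e) tvec \<Rightarrow> real) \<Rightarrow> bool" where
  "one_form M b \<longleftrightarrow>
     (\<forall>p\<in>topspace (mtop M). tangent_linear M p (b p)) \<and>
     (\<forall>c\<in>atlas M. \<forall>i\<in>Basis. smooth_on (chart_image c)
        (\<lambda>x. b (chart_inv c x) (coord_vector M c (chart_inv c x) i)))"

definition riemannian_metric ::
    "('p, 'e::euclidean_space) manifold \<Rightarrow> ('p \<Rightarrow> ('p, 'e) tvec \<Rightarrow> ('p, 'e) tvec \<Rightarrow> real) \<Rightarrow> bool" where
  "riemannian_metric M a \<longleftrightarrow>
     (\<forall>p\<in>topspace (mtop M).
        (\<forall>v\<in>tangent_space M p. tangent_linear M p (a p v)) \<and>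
        (\<forall>v\<in>tangent_space M p. \<forall>w\<in>tangent_space M p. a p v w = a p w v) \<and>
        (\<forall>v\<in>tangent_space M p. v \<noteq> tzero \<longrightarrow> a p v v > 0)) \<and>
     (\<forall>c\<in>atlas M. \<forall>i\<in>Basis. \<forall>j\<in>Basis. smooth_on (chart_image c)
        (\<lambda>x. a (chart_inv c x) (coord_vector M c (chart_inv c x) i)
                                (coord_vector M c (chart_inv c x) j)))"

definition riem_norm ::
    "('p \<Rightarrow> ('p, 'e) tvec \<Rightarrow> ('p, 'e) tvec \<Rightarrow> real) \<Rightarrow> 'p \<Rightarrow> ('p, 'e) tvec \<Rightarrow> real" where
  "riem_norm a p y = sqrt (a p y y)"

definition hessian :: "('e::euclidean_space \<Rightarrow> real) \<Rightarrow> 'e \<Rightarrow> 'e \<Rightarrow> 'e \<Rightarrow> real" where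
  "hessian f y u w = frechet_derivative (\<lambda>z. frechet_derivative f (at z) u) (at y) w"

definition minkowski_norm :: "('e::euclidean_space \<Rightarrow> real) \<Rightarrow> bool" where
  "minkowski_norm N \<longleftrightarrow>
     (\<forall>y. N y \<ge> 0) \<and> smooth_on (UNIV - {0}) N \<and>
     (\<forall>r>0. \<forall>y. N (r *\<^sub>R y) = r * N y) \<and>
     (\<forall>y. y \<noteq> 0 \<longrightarrow> (\<forall>u. u \<noteq> 0 \<longrightarrow> hessian (\<lambda>z. (N z)\<^sup>2 / 2) y u u > 0))"

text \<open>Smoothness of \<open>F\<close> on the slit tangent bundle is stated in the induced coordinates
  \<open>(x\<^sup>i, y\<^sup>i)\<close> of the tangent bundle.\<close>

definition finsler_metric ::
    "('p, 'e::euclidean_space) manifold \<Rightarrow> ('p \<Rightarrow> ('p, 'e) tvec \<Rightarrow> real) \<Rightarrow> bool" where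
  "finsler_metric M F \<longleftrightarrow>
     (\<forall>c\<in>atlas M. smooth_on (chart_image c \<times> (UNIV - {0}))
        (\<lambda>(x, y). F (chart_inv c x) (coord_vector M c (chart_inv c x) y))) \<and>
     (\<forall>p\<in>topspace (mtop M). \<forall>c\<in>charts_at M p. minkowski_norm (\<lambda>y. F p (coord_vector M c p y)))"

text \<open>On zero vectors the formula below gives 0, since \<open>x / 0 = 0\<close>.\<close>

definition exponential_metric ::
    "('p, 'e::euclidean_space) manifold \<Rightarrow> ('p \<Rightarrow> ('p, 'e) tvec \<Rightarrow> ('p, 'e) tvec \<Rightarrow> real) \<Rightarrow>
     ('p \<Rightarrow> ('p, 'e) tvec \<Rightarrow> real) \<Rightarrow> ('p \<Rightarrow> ('p, 'e) tvec \<Rightarrow> real) \<Rightarrow> bool" where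
  "exponential_metric M a b F \<longleftrightarrow>
     riemannian_metric M a \<and> one_form M b \<and> finsler_metric M F \<and>
     (\<forall>p\<in>topspace (mtop M). \<forall>y\<in>tangent_space M p.
        F p y = riem_norm a p y * exp (b p y / riem_norm a p y))"

definition dual_vector_field ::
    "('p, 'e::euclidean_space) manifold \<Rightarrow> ('p \<Rightarrow> ('p, 'e) tvec \<Rightarrow> ('p, 'e) tvec \<Rightarrow> real) \<Rightarrow>
     ('p \<Rightarrow> ('p, 'e) tvec \<Rightarrow> real) \<Rightarrow> ('p \<Rightarrow> ('p, 'e) tvec) \<Rightarrow> bool" where
  "dual_vector_field M a b X \<longleftrightarrow> vector_field M X \<and>
     (\<forall>p\<in>topspace (mtop M). \<forall>y\<in>tangent_space M p. a p (X p) y = b p y)"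


section \<open>Lie groups and reductive coset spaces\<close>

definition lie_group :: "('g, 'x) monoid_scheme \<Rightarrow> ('g, 'e::euclidean_space) manifold \<Rightarrow> bool" where
  "lie_group G GM \<longleftrightarrow> group G \<and> smooth_manifold GM \<and> topspace (mtop GM) = carrier G \<and>
     smooth_map (product_manifold GM GM) GM (\<lambda>(g, h). g \<otimes>\<^bsub>G\<^esub> h) \<and>
     smooth_map GM GM (\<lambda>g. inv\<^bsub>G\<^esub> g)"

text \<open>The smooth structure on \<open>G/H\<close> (left cosets) is the unique one for which the projection
  \<open>g \<mapsto> gH\<close> is a submersion; its topology is then the quotient topology.\<close>

definition coset_manifold ::
    "('g, 'x) monoid_scheme \<Rightarrow> ('g, 'e::euclidean_space) manifold \<Rightarrow> 'g set \<Rightarrow>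
     ('g set, 'f::euclidean_space) manifold \<Rightarrow> bool" where
  "coset_manifold G GM H M \<longleftrightarrow> smooth_manifold M \<and> topspace (mtop M) = lcosets\<^bsub>G\<^esub> H \<and>
     submersion GM M (\<lambda>g. g <#\<^bsub>G\<^esub> H)"

text \<open>The Lie algebra of a closed subgroup \<open>H\<close>, as the subspace \<open>T\<^sub>eH\<close> of \<open>T\<^sub>eG\<close>.\<close>

definition subgroup_lie_algebra ::
    "('g, 'x) monoid_scheme \<Rightarrow> ('g, 'e::euclidean_space) manifold \<Rightarrow> 'g set \<Rightarrow> ('g, 'e) tvec set" where
  "subgroup_lie_algebra G GM H =
     {velocity GM \<gamma> 0 |\<gamma>. smooth_map real_line GM \<gamma> \<and> range \<gamma> \<subseteq> H \<and> \<gamma> 0 = \<one>\<^bsub>G\<^esub>}"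

definition Ad ::
    "('g, 'x) monoid_scheme \<Rightarrow> ('g, 'e::euclidean_space) manifold \<Rightarrow> 'g \<Rightarrow> ('g, 'e) tvec \<Rightarrow> ('g, 'e) tvec" where
  "Ad G GM h = differential GM GM (\<lambda>x. h \<otimes>\<^bsub>G\<^esub> x \<otimes>\<^bsub>G\<^esub> inv\<^bsub>G\<^esub> h) \<one>\<^bsub>G\<^esub>"

definition reductive_decomposition ::
    "('g, 'x) monoid_scheme \<Rightarrow> ('g, 'e::euclidean_space) manifold \<Rightarrow> 'g set \<Rightarrow> ('g, 'e) tvec set \<Rightarrow> bool" where
  "reductive_decomposition G GM H \<mm> \<longleftrightarrow>
     tangent_subspace GM \<one>\<^bsub>G\<^esub> \<mm> \<and>
     subgroup_lie_algebra G GM H \<inter> \<mm> = {tzero} \<and>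
     (\<forall>v\<in>tangent_space GM \<one>\<^bsub>G\<^esub>. \<exists>u\<in>subgroup_lie_algebra G GM H. \<exists>w\<in>\<mm>. v = tadd u w) \<and>
     (\<forall>h\<in>H. Ad G GM h ` \<mm> \<subseteq> \<mm>)"


section \<open>Invariance under the left action of the group on the coset space\<close>

text \<open>The element \<open>g\<close> acts on \<open>G/H\<close> by \<open>p \<mapsto> g p\<close>, which on a left coset \<open>p\<close> is the operation
  \<open>l_coset\<close>.\<close>

definition d_action ::
    "('g, 'x) monoid_scheme \<Rightarrow> ('g set, 'f::euclidean_space) manifold \<Rightarrow> 'g \<Rightarrow> 'g set \<Rightarrow>
     ('g set, 'f) tvec \<Rightarrow> ('g set, 'f) tvec" where
  "d_action G M g p = differential M M (\<lambda>q. g <#\<^bsub>G\<^esub> q) p"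

definition invariant_finsler_metric ::
    "('g, 'x) monoid_scheme \<Rightarrow> ('g set, 'f::euclidean_space) manifold \<Rightarrow>
     ('g set \<Rightarrow> ('g set, 'f) tvec \<Rightarrow> real) \<Rightarrow> bool" where
  "invariant_finsler_metric G M F \<longleftrightarrow> finsler_metric M F \<and>
     (\<forall>g\<in>carrier G. \<forall>p\<in>topspace (mtop M). \<forall>y\<in>tangent_space M p.
        F (g <#\<^bsub>G\<^esub> p) (d_action G M g p y) = F p y)"

definition invariant_riemannian_metric ::
    "('g, 'x) monoid_scheme \<Rightarrow> ('g set, 'f::euclidean_space) manifold \<Rightarrow>
     ('g set \<Rightarrow> ('g set, 'f) tvec \<Rightarrow> ('g set, 'f) tvec \<Rightarrow> real) \<Rightarrow> bool" where
  "invariant_riemannian_metric G M a \<longleftrightarrow> riemannian_metric M a \<and>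
     (\<forall>g\<in>carrier G. \<forall>p\<in>topspace (mtop M). \<forall>v\<in>tangent_space M p. \<forall>w\<in>tangent_space M p.
        a (g <#\<^bsub>G\<^esub> p) (d_action G M g p v) (d_action G M g p w) = a p v w)"

definition invariant_vector_field ::
    "('g, 'x) monoid_scheme \<Rightarrow> ('g set, 'f::euclidean_space) manifold \<Rightarrow>
     ('g set \<Rightarrow> ('g set, 'f) tvec) \<Rightarrow> bool" where
  "invariant_vector_field G M X \<longleftrightarrow> vector_field M X \<and>
     (\<forall>g\<in>carrier G. \<forall>p\<in>topspace (mtop M). d_action G M g p (X p) = X (g <#\<^bsub>G\<^esub> p))"

end

theory Submission
  imports Defs
begin

text \<open>Since \<open>F(y) F(-y) = \<alpha>(y)\<^sup>2\<close>, every linear map between tangent spaces that preserves \<open>F\<close> preserves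
  \<open>\<alpha>\<close>, hence also \<open>\<beta> = \<alpha> ln (F/\<alpha>)\<close>, and if it is onto it maps \<open>X\<close> to \<open>X\<close>. What remains is
  that the translations of \<open>G/H\<close> are differentiable, which makes their differentials linear: the
  projection \<open>G \<rightarrow> G/H\<close> is a submersion, so it has differentiable local sections by the inverse
  function theorem, and along a section a translation of \<open>G/H\<close> is a translation of \<open>G\<close> followed
  by the projection.\<close>

section \<open>Local sections of maps with surjective derivative\<close>

lemma smooth_on_imp_differentiable:
  assumes "smooth_on S f" "x \<in> S"
  shows "f differentiable at x"
  using assms(1)[unfolded smooth_on_def, rule_format, of "Suc 0"] assms(2) by simp

lemma smooth_on_imp_continuous_frechet_derivative:
  assumes "smooth_on S f"
  shows "continuous_on S (\<lambda>x. frechet_derivative f (at x) v)"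
  using assms[unfolded smooth_on_def, rule_format, of "Suc 0"] by simp

text \<open>A right inverse R of the derivative at x0 selects an affine slice \<open>h\<close> u =
  x0 + R u through x0, transversal to the fibre. On this slice the map becomes one between open
  subsets of the same space, with derivative the identity at 0. The inverse function theorem inverts
  it by some \<open>g\<close>, and the section is \<open>h\<close> after \<open>g\<close>.\<close>

lemma smooth_on_local_section:
  fixes \<phi> :: "'a::euclidean_space \<Rightarrow> 'b::euclidean_space"
  assumes "open S" "x0 \<in> S" and smooth: "smooth_on S \<phi>"
    and surj: "surj (frechet_derivative \<phi> (at x0))"
  obtains V \<sigma> where "open V" "\<phi> x0 \<in> V" "\<sigma> (\<phi> x0) = x0" "\<sigma> differentiable at (\<phi> x0)"
    "\<And>z. z \<in> V \<Longrightarrow> \<sigma> z \<in> S \<and> \<phi> (\<sigma> z) = z"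
proof -
  let ?D = "\<lambda>x. frechet_derivative \<phi> (at x)"
  have der: "(\<phi> has_derivative ?D x) (at x)" if "x \<in> S" for x
    using smooth_on_imp_differentiable[OF smooth that] frechet_derivative_works by blast
  obtain R where R: "linear R" "?D x0 \<circ> R = id"
    using linear_surjective_right_inverse[OF _ surj] der[OF \<open>x0 \<in> S\<close>] has_derivative_linear by blast
  have blR: "bounded_linear R"
    using R(1) by (simp add: linear_conv_bounded_linear)
  define h where "h u = x0 + R u" for u
  have h0: "h 0 = x0"
    by (simp add: h_def linear_0[OF R(1)])
  have derh: "(h has_derivative R) (at u)" for u
    unfolding h_def by (auto intro!: derivative_eq_intros bounded_linear_imp_has_derivative blR)
  have conth: "continuous_on T h" for T
    by (meson continuous_at_imp_continuous_on derh has_derivative_continuous)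
  define U where "U = h -` S"
  have U: "open U" "0 \<in> U"
    using open_vimage[OF \<open>open S\<close> conth] h0 \<open>x0 \<in> S\<close> by (auto simp: U_def)
  \<comment> \<open>The inverse function theorem asks for a derivative that is continuous as a map
    into bounded operators. \<open>Blinfun\<close> packages it as such, and in finite dimension
    continuity can be checked on basis vectors.\<close>
  define \<psi>' where "\<psi>' u = Blinfun (?D (h u) \<circ> R)" for u
  have \<psi>'_apply: "blinfun_apply (\<psi>' u) = ?D (h u) \<circ> R" if "u \<in> U" for u
    unfolding \<psi>'_def using that der[of "h u"] blR has_derivative_bounded_linear
    by (intro bounded_linear_Blinfun_apply) (auto simp: U_def o_def intro: bounded_linear_compose)
  have der\<psi>: "(\<phi> \<circ> h has_derivative blinfun_apply (\<psi>' u)) (at u)" if "u \<in> U" for u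
    unfolding \<psi>'_apply[OF that] using that by (intro diff_chain_at derh der) (auto simp: U_def)
  have cont\<psi>': "continuous_on U \<psi>'"
  proof (rule continuous_on_blinfun_componentwise)
    fix i
    have "continuous_on U (\<lambda>u. ?D (h u) (R i))"
      using continuous_on_compose2[OF smooth_on_imp_continuous_frechet_derivative[OF smooth] conth]
      by (auto simp: U_def)
    then show "continuous_on U (\<lambda>u. blinfun_apply (\<psi>' u) i)"
      by (rule continuous_on_eq) (simp add: \<psi>'_apply)
  qed
  \<comment> \<open>By the choice of R the derivative of the restricted map at 0 is the identity, so
    the identity serves as its inverse.\<close>
  have inv: "id_blinfun o\<^sub>L \<psi>' 0 = id_blinfun"
    by (rule blinfun_eqI) (simp add: \<psi>'_apply[OF U(2)] h0 R(2)[unfolded fun_eq_iff, simplified])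
  obtain U' V g g' where UV: "open U'" "U' \<subseteq> U" "0 \<in> U'" "open V" "(\<phi> \<circ> h) 0 \<in> V"
    "homeomorphism U' V (\<phi> \<circ> h) g" "\<And>y. y \<in> V \<Longrightarrow> (g has_derivative (g' y)) (at y)"
    by (rule inverse_function_theorem[OF U(1) der\<psi> cont\<psi>' U(2) inv]) blast+
  show thesis
  proof (rule that[of V "h \<circ> g"])
    show "\<phi> x0 \<in> V"
      using UV(5) h0 by simp
    have "g (\<phi> x0) = 0"
      using homeomorphism_apply1[OF UV(6,3)] h0 by simp
    then show "(h \<circ> g) (\<phi> x0) = x0"
      using h0 by simp
    show "(h \<circ> g) differentiable at (\<phi> x0)"
      using UV(7)[OF \<open>\<phi> x0 \<in> V\<close>] derh by (intro differentiable_chain_at) (auto simp: differentiable_def)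
    show "(h \<circ> g) z \<in> S \<and> \<phi> ((h \<circ> g) z) = z" if "z \<in> V" for z
      using homeomorphism_apply2[OF UV(6) that] homeomorphism_image2[OF UV(6)] UV(2) that
      by (auto simp: U_def)
  qed (rule UV(4))
qed

section \<open>Differentiable maps between manifolds\<close>

lemma charts_atD:
  assumes "smooth_manifold M" "c \<in> charts_at M p"
  shows "c \<in> atlas M" "p \<in> fst c" "is_chart (mtop M) c" "p \<in> topspace (mtop M)"
proof -
  show c: "c \<in> atlas M" "p \<in> fst c"
    using assms(2) by (auto simp: charts_at_def)
  show chart: "is_chart (mtop M) c"
    using assms(1) c(1) by (simp add: smooth_manifold_def)
  show "p \<in> topspace (mtop M)"
    using chart c(2) openin_subset unfolding is_chart_def by blast
qed

lemma ex_charts_at: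
  assumes "smooth_manifold M" "p \<in> topspace (mtop M)"
  shows "\<exists>c. c \<in> charts_at M p"
  using assms unfolding smooth_manifold_def by blast

lemma chart_inj_on:
  assumes "is_chart T c"
  shows "inj_on (snd c) (fst c)"
proof -
  have "topspace (subtopology T (fst c)) = fst c"
    using assms openin_subset unfolding is_chart_def by fastforce
  then show ?thesis
    using assms homeomorphic_imp_injective_map unfolding is_chart_def by metis
qed

lemma chart_inv_apply:
  assumes "is_chart T c" "q \<in> fst c"
  shows "chart_inv c (snd c q) = q"
  using assms unfolding chart_inv_def by (simp add: chart_inj_on)

lemma open_chart_image:
  assumes c: "is_chart T c" and "openin T U"
  shows "open (snd c ` (fst c \<inter> U))"
proof -
  have "openin (subtopology T (fst c)) (fst c \<inter> U)"
    using assms by (metis inf_commute openin_subtopology_Int)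
  then have "openin (top_of_set (chart_image c)) (snd c ` (fst c \<inter> U))"
    using c openin_subset homeomorphic_map_openness unfolding is_chart_def by metis
  then show ?thesis
    using c openin_open_trans unfolding is_chart_def by blast
qed

text \<open>\<open>chart_inv\<close> is an \<open>inv_into\<close>, hence arbitrary off the chart
  image. Identities in coordinates therefore hold only on a neighbourhood, which is enough for
  derivatives.\<close>

lemma eventually_chart_inv:
  assumes c: "is_chart T c" and "q \<in> fst c" "openin T U" "q \<in> U"
  shows "\<forall>\<^sub>F z in nhds (snd c q). chart_inv c z \<in> fst c \<inter> U \<and> snd c (chart_inv c z) = z"
  unfolding eventually_nhds
  using assms open_chart_image[OF c \<open>openin T U\<close>] chart_inv_apply[OF c]
  by (intro exI[of _ "snd c ` (fst c \<inter> U)"]) auto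

lemma chart_inv_charts_at:
  assumes "smooth_manifold M" "c \<in> charts_at M p"
  shows "chart_inv c (snd c p) = p"
  using charts_atD[OF assms] by (intro chart_inv_apply)

lemma has_derivative_transform_eventually_nhds:
  assumes f: "(f has_derivative D) (at x)" and "\<forall>\<^sub>F z in nhds x. f z = g z"
  shows "(g has_derivative D) (at x)"
proof -
  obtain S where "open S" "x \<in> S" "\<forall>z\<in>S. f z = g z"
    using assms(2) unfolding eventually_nhds by blast
  then show ?thesis
    by (intro has_derivative_transform_within_open[OF f]) auto
qed

text \<open>The eventuality clause stands in for continuity: coordinate maps have irrelevant values
  off their domains, so a local expression means something only where f lands in the target chart.
  Differentiability at one point is the notion that survives composition with the local section,
  which is known to be differentiable only at its base point.\<close>

definition mdifferentiable_at ::
    "('p, 'e::euclidean_space) manifold \<Rightarrow> ('q, 'f::euclidean_space) manifold \<Rightarrow> ('p \<Rightarrow> 'q) \<Rightarrow> 'p \<Rightarrow> bool" where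
  "mdifferentiable_at M N f p \<longleftrightarrow>
     (\<forall>c\<in>charts_at M p. \<forall>d\<in>charts_at N (f p).
        (\<forall>\<^sub>F z in nhds (snd c p). f (chart_inv c z) \<in> fst d) \<and>
        (snd d \<circ> f \<circ> chart_inv c) differentiable at (snd c p))"

lemma mdifferentiable_atD:
  assumes "mdifferentiable_at M N f p" "c \<in> charts_at M p" "d \<in> charts_at N (f p)"
  shows "\<forall>\<^sub>F z in nhds (snd c p). f (chart_inv c z) \<in> fst d"
    and "((snd d \<circ> f \<circ> chart_inv c) has_derivative
          frechet_derivative (snd d \<circ> f \<circ> chart_inv c) (at (snd c p))) (at (snd c p))"
  using assms by (auto simp: mdifferentiable_at_def frechet_derivative_works[symmetric])

lemma open_vimage_chart:
  assumes "is_chart S c" "is_chart T d" "continuous_map S T f"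
  shows "open (snd c ` {q \<in> fst c. f q \<in> fst d})"
proof -
  have "openin S {q \<in> topspace S. f q \<in> fst d}"
    using assms(2,3) openin_continuous_map_preimage[of S T f "fst d"] unfolding is_chart_def by auto
  then have "open (snd c ` (fst c \<inter> {q \<in> topspace S. f q \<in> fst d}))"
    by (rule open_chart_image[OF assms(1)])
  moreover have "fst c \<inter> {q \<in> topspace S. f q \<in> fst d} = {q \<in> fst c. f q \<in> fst d}"
    using assms(1) openin_subset unfolding is_chart_def by blast
  ultimately show ?thesis
    by simp
qed

lemma smooth_map_imp_mdifferentiable_at:
  assumes "smooth_manifold M" "smooth_manifold N" and f: "smooth_map M N f"
  shows "mdifferentiable_at M N f p"
  unfolding mdifferentiable_at_def
proof (intro ballI conjI)
  fix c d assume cd: "c \<in> charts_at M p" "d \<in> charts_at N (f p)"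
  note c = charts_atD[OF assms(1) cd(1)] and d = charts_atD[OF assms(2) cd(2)]
  let ?S = "snd c ` {q \<in> fst c. f q \<in> fst d}"
  have S: "open ?S" "snd c p \<in> ?S"
    using open_vimage_chart[OF c(3) d(3)] f c d unfolding smooth_map_def by auto
  show "(snd d \<circ> f \<circ> chart_inv c) differentiable at (snd c p)"
    using f c(1) d(1) S(2) smooth_on_imp_differentiable unfolding smooth_map_def by blast
  show "\<forall>\<^sub>F z in nhds (snd c p). f (chart_inv c z) \<in> fst d"
    unfolding eventually_nhds using S chart_inv_apply[OF c(3)] by (intro exI[of _ ?S]) auto
qed

text \<open>The local expressions of the identity are the transition maps. The chain rule with an
  identity factor thus yields every change of chart below.\<close>

lemma mdifferentiable_at_id:
  assumes "smooth_manifold M"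
  shows "mdifferentiable_at M M (\<lambda>q. q) p"
proof (rule smooth_map_imp_mdifferentiable_at[OF assms assms])
  have "{q \<in> fst c. q \<in> fst d} = fst c \<inter> fst d" for c d :: "('a, 'b) chart"
    by blast
  moreover have "snd d \<circ> (\<lambda>q. q) \<circ> chart_inv c = snd d \<circ> chart_inv c" for c d :: "('a, 'b) chart"
    by (simp add: o_def)
  ultimately show "smooth_map M M (\<lambda>q. q)"
    using assms by (simp add: smooth_map_def smooth_manifold_def)
qed

text \<open>The product of the local expressions of g and f equals the local expression of their
  composite only where f stays in the intermediate chart d. The eventuality clause for f provides a
  neighbourhood where this holds, and the derivative depends on nothing more.\<close>

lemma frechet_derivative_chart_chain:
  assumes N: "smooth_manifold N"
    and f: "mdifferentiable_at M N f p" and g: "mdifferentiable_at N P g (f p)"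
    and c: "c \<in> charts_at M p" and d: "d \<in> charts_at N (f p)" and e: "e \<in> charts_at P (g (f p))"
    and cp: "chart_inv c (snd c p) = p"
  shows "((snd e \<circ> (g \<circ> f) \<circ> chart_inv c) has_derivative
           (frechet_derivative (snd e \<circ> g \<circ> chart_inv d) (at (snd d (f p))) \<circ>
            frechet_derivative (snd d \<circ> f \<circ> chart_inv c) (at (snd c p)))) (at (snd c p))"
    (is "(_ has_derivative ?D) _")
    and "\<forall>\<^sub>F z in nhds (snd c p). (g \<circ> f) (chart_inv c z) \<in> fst e"
proof -
  let ?f = "snd d \<circ> f \<circ> chart_inv c" and ?g = "snd e \<circ> g \<circ> chart_inv d"
  note f' = mdifferentiable_atD[OF f c d] and g' = mdifferentiable_atD[OF g d e]
  have fp: "?f (snd c p) = snd d (f p)"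
    by (simp add: cp)
  have inv_d: "\<forall>\<^sub>F z in nhds (snd c p). chart_inv d (?f z) = f (chart_inv c z)"
    using f'(1) chart_inv_apply[OF charts_atD(3)[OF N d]] by (auto elim: eventually_mono)
  have "((?g \<circ> ?f) has_derivative ?D) (at (snd c p))"
    using f'(2) g'(2) by (intro diff_chain_at) (simp_all only: fp)
  moreover have "\<forall>\<^sub>F z in nhds (snd c p). (?g \<circ> ?f) z = (snd e \<circ> (g \<circ> f) \<circ> chart_inv c) z"
    using inv_d by eventually_elim simp
  ultimately show "((snd e \<circ> (g \<circ> f) \<circ> chart_inv c) has_derivative ?D) (at (snd c p))"
    by (rule has_derivative_transform_eventually_nhds)
  \<comment> \<open>Continuity of the local expression of f pulls back the neighbourhood on which g
    lands in the chart e.\<close>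
  have "filterlim ?f (nhds (?f (snd c p))) (nhds (snd c p))"
    using has_derivative_continuous[OF f'(2)] by (simp only: continuous_at tendsto_at_iff_tendsto_nhds)
  from eventually_compose_filterlim[OF g'(1)[folded fp] this]
  have "\<forall>\<^sub>F z in nhds (snd c p). g (chart_inv d (?f z)) \<in> fst e" .
  with inv_d show "\<forall>\<^sub>F z in nhds (snd c p). (g \<circ> f) (chart_inv c z) \<in> fst e"
    by eventually_elim simp
qed

lemma mdifferentiable_at_compose:
  assumes M: "smooth_manifold M" and N: "smooth_manifold N"
    and f: "mdifferentiable_at M N f p" and g: "mdifferentiable_at N P g (f p)"
    and fp: "f p \<in> topspace (mtop N)"
  shows "mdifferentiable_at M P (g \<circ> f) p"
  unfolding mdifferentiable_at_def
proof (intro ballI)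
  fix c e assume c: "c \<in> charts_at M p" and e: "e \<in> charts_at P ((g \<circ> f) p)"
  obtain d where d: "d \<in> charts_at N (f p)"
    using ex_charts_at[OF N fp] by blast
  have cp: "chart_inv c (snd c p) = p"
    by (rule chart_inv_charts_at[OF M c])
  have "e \<in> charts_at P (g (f p))"
    using e by simp
  from frechet_derivative_chart_chain[OF N f g c d this cp]
  show "(\<forall>\<^sub>F z in nhds (snd c p). (g \<circ> f) (chart_inv c z) \<in> fst e) \<and>
        (snd e \<circ> (g \<circ> f) \<circ> chart_inv c) differentiable at (snd c p)"
    unfolding differentiable_def by blast
qed

section \<open>Tangent spaces and differentials\<close>

lemma tangent_spaceI:
  assumes "\<And>c d. c \<in> charts_at M p \<Longrightarrow> d \<in> charts_at M p \<Longrightarrow>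
      v d = frechet_derivative (snd d \<circ> chart_inv c) (at (snd c p)) (v c)"
    and "\<And>c. c \<notin> charts_at M p \<Longrightarrow> v c = 0"
  shows "v \<in> tangent_space M p"
  using assms unfolding tangent_space_def by blast

lemma tangent_spaceD:
  assumes "v \<in> tangent_space M p"
  shows "c \<in> charts_at M p \<Longrightarrow> d \<in> charts_at M p \<Longrightarrow>
      v d = frechet_derivative (snd d \<circ> chart_inv c) (at (snd c p)) (v c)"
    and "c \<notin> charts_at M p \<Longrightarrow> v c = 0"
  using assms unfolding tangent_space_def by blast+

text \<open>One component determines a tangent vector: the transformation law gives the components
  at all other charts at p, and the remaining ones are 0. Equalities can so be checked in a single
  chart.\<close>

lemma tangent_space_eqI:
  assumes v: "v \<in> tangent_space M p" and w: "w \<in> tangent_space M p"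
    and c: "c \<in> charts_at M p" and eq: "v c = w c"
  shows "v = w"
proof
  fix d
  show "v d = w d"
  proof (cases "d \<in> charts_at M p")
    case True
    show ?thesis
      unfolding tangent_spaceD(1)[OF v c True] tangent_spaceD(1)[OF w c True] eq ..
  next
    case False
    then show ?thesis
      using tangent_spaceD(2)[OF v] tangent_spaceD(2)[OF w] by simp
  qed
qed

lemma linear_transition:
  assumes "smooth_manifold M" "c \<in> charts_at M p" "d \<in> charts_at M p"
  shows "linear (frechet_derivative (snd d \<circ> chart_inv c) (at (snd c p)))"
  using has_derivative_linear[OF mdifferentiable_atD(2)[OF mdifferentiable_at_id[OF assms(1)]]] assms
  by (simp add: o_def)

lemma tangent_space_tadd:
  assumes M: "smooth_manifold M" and v: "v \<in> tangent_space M p" and w: "w \<in> tangent_space M p"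
  shows "tadd v w \<in> tangent_space M p"
proof (rule tangent_spaceI)
  fix c d assume cd: "c \<in> charts_at M p" "d \<in> charts_at M p"
  show "tadd v w d = frechet_derivative (snd d \<circ> chart_inv c) (at (snd c p)) (tadd v w c)"
    unfolding tadd_def linear_add[OF linear_transition[OF M cd]]
      tangent_spaceD(1)[OF v cd] tangent_spaceD(1)[OF w cd] ..
qed (simp add: tadd_def tangent_spaceD(2)[OF v] tangent_spaceD(2)[OF w])

lemma tangent_space_tscale:
  assumes M: "smooth_manifold M" and v: "v \<in> tangent_space M p"
  shows "tscale r v \<in> tangent_space M p"
proof (rule tangent_spaceI)
  fix c d assume cd: "c \<in> charts_at M p" "d \<in> charts_at M p"
  show "tscale r v d = frechet_derivative (snd d \<circ> chart_inv c) (at (snd c p)) (tscale r v c)"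
    unfolding tscale_def linear_cmul[OF linear_transition[OF M cd]] tangent_spaceD(1)[OF v cd] ..
qed (simp add: tscale_def tangent_spaceD(2)[OF v])

lemma tangent_space_tzero:
  assumes "smooth_manifold M"
  shows "tzero \<in> tangent_space M p"
  using linear_transition[OF assms] unfolding tangent_space_def tzero_def
  by (simp add: linear_0)

text \<open>The transformation law from d to e is the chain rule for f followed by the identity of
  N, read with d as intermediate chart.\<close>

lemma differential_in_tangent_space:
  assumes M: "smooth_manifold M" and N: "smooth_manifold N"
    and f: "mdifferentiable_at M N f p" and p: "p \<in> topspace (mtop M)"
  shows "differential M N f p v \<in> tangent_space N (f p)"
proof -
  define c where "c = (SOME c. c \<in> charts_at M p)"
  have c: "c \<in> charts_at M p"
    unfolding c_def using ex_charts_at[OF M p] by (rule someI_ex)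
  have cp: "chart_inv c (snd c p) = p"
    by (rule chart_inv_charts_at[OF M c])
  have chain: "frechet_derivative (snd e \<circ> f \<circ> chart_inv c) (at (snd c p)) (v c) =
      frechet_derivative (snd e \<circ> chart_inv d) (at (snd d (f p)))
        (frechet_derivative (snd d \<circ> f \<circ> chart_inv c) (at (snd c p)) (v c))"
    if de: "d \<in> charts_at N (f p)" "e \<in> charts_at N (f p)" for d e
    using fun_cong[OF frechet_derivative_at[OF frechet_derivative_chart_chain(1)
        [OF N f mdifferentiable_at_id[OF N] c de cp]], of "v c"]
    unfolding o_def by (rule sym)
  show ?thesis
  proof (rule tangent_spaceI)
    fix d e assume de: "d \<in> charts_at N (f p)" "e \<in> charts_at N (f p)"
    show "differential M N f p v e = frechet_derivative (snd e \<circ> chart_inv d) (at (snd d (f p)))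
        (differential M N f p v d)"
      using chain[OF de] de by (simp only: differential_def c_def[symmetric] Let_def if_True)
  qed (simp add: differential_def Let_def)
qed

lemma
  assumes M: "smooth_manifold M" and f: "mdifferentiable_at M N f p" and p: "p \<in> topspace (mtop M)"
  shows differential_tadd:
      "differential M N f p (tadd v w) = tadd (differential M N f p v) (differential M N f p w)"
    and differential_tscale: "differential M N f p (tscale r v) = tscale r (differential M N f p v)"
proof -
  define c where "c = (SOME c. c \<in> charts_at M p)"
  have c: "c \<in> charts_at M p"
    unfolding c_def using ex_charts_at[OF M p] by (rule someI_ex)
  have "linear (frechet_derivative (snd d \<circ> f \<circ> chart_inv c) (at (snd c p)))"
    if "d \<in> charts_at N (f p)" for d
    using mdifferentiable_atD(2)[OF f c that] by (rule has_derivative_linear)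
  then show "differential M N f p (tadd v w) = tadd (differential M N f p v) (differential M N f p w)"
    and "differential M N f p (tscale r v) = tscale r (differential M N f p v)"
    by (auto simp: differential_def c_def[symmetric] tadd_def tscale_def linear_add linear_cmul)
qed

lemma coord_vector_in_tangent_space:
  assumes M: "smooth_manifold M" and c: "c \<in> charts_at M p"
  shows "coord_vector M c p y \<in> tangent_space M p"
proof -
  have cp: "chart_inv c (snd c p) = p"
    by (rule chart_inv_charts_at[OF M c])
  have chain: "frechet_derivative (snd e \<circ> chart_inv c) (at (snd c p)) y =
      frechet_derivative (snd e \<circ> chart_inv d) (at (snd d p))
        (frechet_derivative (snd d \<circ> chart_inv c) (at (snd c p)) y)"
    if de: "d \<in> charts_at M p" "e \<in> charts_at M p" for d e
    using fun_cong[OF frechet_derivative_at[OF frechet_derivative_chart_chain(1)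
        [OF M mdifferentiable_at_id[OF M] mdifferentiable_at_id[OF M] c de cp]], of y]
    unfolding o_def by (rule sym)
  show ?thesis
  proof (rule tangent_spaceI)
    fix d e assume de: "d \<in> charts_at M p" "e \<in> charts_at M p"
    show "coord_vector M c p y e = frechet_derivative (snd e \<circ> chart_inv d) (at (snd d p))
        (coord_vector M c p y d)"
      using chain[OF de] de by (simp only: coord_vector_def if_True)
  qed (simp add: coord_vector_def)
qed

text \<open>The local expression of the identity in a single chart is the identity near the point.
  Together with \<open>tangent_space_eqI\<close> this makes evaluation at c an isomorphism from the
  tangent space onto the model space, with inverse \<open>coord_vector M c p\<close>.\<close>

lemma coord_vector_same_chart:
  assumes M: "smooth_manifold M" and c: "c \<in> charts_at M p"
  shows "coord_vector M c p y c = y"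
proof -
  note c' = charts_atD[OF M c]
  have ev: "\<forall>\<^sub>F z in nhds (snd c p). (snd c \<circ> chart_inv c) z = z"
    using eventually_chart_inv[OF c'(3,2) openin_topspace c'(4)] by eventually_elim simp
  have "((snd c \<circ> chart_inv c) has_derivative (\<lambda>x. x)) (at (snd c p))"
    using ev by (intro has_derivative_transform_eventually_nhds[OF has_derivative_ident])
      (auto elim: eventually_mono)
  then show ?thesis
    using c by (simp add: coord_vector_def frechet_derivative_at[symmetric])
qed

text \<open>Both manifolds are modelled on the same Euclidean space. Coordinates at p and q turn L
  into a linear endomorphism \<open>l\<close> of that space, for which injectivity implies
  surjectivity.\<close>

lemma tangent_space_inj_imp_surj:
  fixes M :: "('p, 'e::euclidean_space) manifold" and N :: "('q, 'e) manifold"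
  assumes M: "smooth_manifold M" and N: "smooth_manifold N"
    and p: "p \<in> topspace (mtop M)" and q: "q \<in> topspace (mtop N)"
    and L: "\<And>v. v \<in> tangent_space M p \<Longrightarrow> L v \<in> tangent_space N q"
    and add: "\<And>v w. v \<in> tangent_space M p \<Longrightarrow> w \<in> tangent_space M p \<Longrightarrow> L (tadd v w) = tadd (L v) (L w)"
    and scale: "\<And>r v. v \<in> tangent_space M p \<Longrightarrow> L (tscale r v) = tscale r (L v)"
    and inj: "\<And>v. v \<in> tangent_space M p \<Longrightarrow> L v = tzero \<Longrightarrow> v = tzero"
  shows "L ` tangent_space M p = tangent_space N q"
proof -
  obtain c d where c: "c \<in> charts_at M p" and d: "d \<in> charts_at N q"
    using ex_charts_at M N p q by metis
  let ?C = "coord_vector M c p"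
  define l where "l y = L (?C y) d" for y
  note C = coord_vector_in_tangent_space[OF M c] and C_same = coord_vector_same_chart[OF M c]
  have C_add: "?C (x + y) = tadd (?C x) (?C y)" for x y
    by (rule tangent_space_eqI[OF C tangent_space_tadd[OF M C C] c]) (simp add: tadd_def C_same)
  have C_scale: "?C (r *\<^sub>R y) = tscale r (?C y)" for r y
    by (rule tangent_space_eqI[OF C tangent_space_tscale[OF M C] c]) (simp add: tscale_def C_same)
  have "linear l"
    by (rule linearI; simp only: l_def C_add C_scale add[OF C C] scale[OF C])
       (simp_all add: tadd_def tscale_def)
  moreover have "y = 0" if "l y = 0" for y
  proof -
    have "L (?C y) = tzero"
      by (rule tangent_space_eqI[OF L[OF C] tangent_space_tzero[OF N] d]) (use that in \<open>simp add: l_def tzero_def\<close>)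
    then have "?C y = tzero"
      by (rule inj[OF C])
    then show "y = 0"
      using C_same[of y] by (simp add: tzero_def)
  qed
  ultimately have "surj l"
    by (simp add: linear_injective_0 linear_injective_imp_surjective)
  have "w \<in> L ` tangent_space M p" if w: "w \<in> tangent_space N q" for w
  proof -
    obtain y where "w d = l y"
      using \<open>surj l\<close> by (metis surjD)
    then have "w = L (?C y)"
      using tangent_space_eqI[OF w L[OF C] d] by (simp add: l_def)
    then show ?thesis
      using C by blast
  qed
  then show ?thesis
    using L by blast
qed

section \<open>Descent along a submersion\<close>

text \<open>Let \<sigma> be a local section of the projection written in charts e and c. Near the
  base point \<open>chart_inv c\<close> is the projection after \<open>chart_inv e\<close> after
  \<sigma>, so the local expression of f is that of the composite of f with the projection,
  precomposed with \<sigma>.\<close>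

lemma mdifferentiable_at_submersion_descend:
  assumes P: "smooth_manifold P" and M: "smooth_manifold M"
    and sub: "submersion P M \<pi>" and x: "x \<in> topspace (mtop P)"
    and f: "mdifferentiable_at P N (f \<circ> \<pi>) x"
  shows "mdifferentiable_at M N f (\<pi> x)"
  unfolding mdifferentiable_at_def
proof (intro ballI)
  fix c d assume c: "c \<in> charts_at M (\<pi> x)" and d: "d \<in> charts_at N (f (\<pi> x))"
  \<comment> \<open>This is the chart that \<open>differential\<close> selects, so surjectivity of
    the differential becomes surjectivity of the derivative of \<open>?\<phi>\<close>.\<close>
  define e where "e = (SOME c. c \<in> charts_at P x)"
  have e: "e \<in> charts_at P x"
    unfolding e_def using ex_charts_at[OF P x] by (rule someI_ex)
  note c' = charts_atD[OF M c] and e' = charts_atD[OF P e]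
  have smooth: "smooth_map P M \<pi>"
    using sub by (simp add: submersion_def)
  let ?S = "snd e ` {q \<in> fst e. \<pi> q \<in> fst c}" and ?\<phi> = "snd c \<circ> \<pi> \<circ> chart_inv e"
  let ?g = "snd d \<circ> (f \<circ> \<pi>) \<circ> chart_inv e" and ?z0 = "snd c (\<pi> x)"
  have \<phi>0: "?\<phi> (snd e x) = ?z0"
    using chart_inv_apply[OF e'(3,2)] by simp
  have surj: "surj (frechet_derivative ?\<phi> (at (snd e x)))"
    unfolding surj_def
  proof
    fix y
    have "coord_vector M c (\<pi> x) y \<in> differential P M \<pi> x ` tangent_space P x"
      using coord_vector_in_tangent_space[OF M c] sub x by (simp add: submersion_def)
    then obtain v where v: "coord_vector M c (\<pi> x) y = differential P M \<pi> x v"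
      by blast
    have "y = differential P M \<pi> x v c"
      using coord_vector_same_chart[OF M c, of y] v by simp
    then show "\<exists>v. y = frechet_derivative ?\<phi> (at (snd e x)) v"
      using c by (auto simp: differential_def e_def[symmetric])
  qed
  have smooth_\<phi>: "smooth_on ?S ?\<phi>"
    using smooth c'(1) e'(1) by (simp add: smooth_map_def)
  have open_S: "open ?S"
    using smooth by (intro open_vimage_chart[OF e'(3) c'(3)]) (simp add: smooth_map_def)
  have S0: "snd e x \<in> ?S"
    using c'(2) e'(2) by blast
  obtain V \<sigma> where V: "open V" "?z0 \<in> V" and \<sigma>0: "\<sigma> ?z0 = snd e x"
    and d\<sigma>: "\<sigma> differentiable at ?z0" and \<sigma>: "\<And>z. z \<in> V \<Longrightarrow> \<sigma> z \<in> ?S \<and> ?\<phi> (\<sigma> z) = z"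
    by (rule smooth_on_local_section[OF open_S S0 smooth_\<phi> surj, unfolded \<phi>0]) (rule that)
  have section_eq: "chart_inv c z = \<pi> (chart_inv e (\<sigma> z))" if z: "z \<in> V" for z
  proof -
    obtain q where q: "q \<in> fst e" "\<pi> q \<in> fst c" "\<sigma> z = snd e q"
      using \<sigma>[OF z] by blast
    then have "z = snd c (\<pi> q)"
      using \<sigma>[OF z] chart_inv_apply[OF e'(3)] by simp
    then show ?thesis
      using q chart_inv_apply[OF e'(3)] chart_inv_apply[OF c'(3)] by simp
  qed
  have d': "d \<in> charts_at N ((f \<circ> \<pi>) x)"
    using d by simp
  note f' = mdifferentiable_atD[OF f e d']
  have "?g differentiable at (\<sigma> ?z0)"
    using f'(2) unfolding \<sigma>0 differentiable_def by blast
  with d\<sigma> have "(?g \<circ> \<sigma>) differentiable at ?z0"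
    by (rule differentiable_chain_at)
  then have "(snd d \<circ> f \<circ> chart_inv c) differentiable at ?z0"
    unfolding differentiable_def
    by (elim ex_forward has_derivative_transform_within_open[OF _ V]) (simp add: section_eq)
  \<comment> \<open>Continuity of \<sigma> at the base point transports the eventuality clause from
    G to the quotient.\<close>
  moreover have "filterlim \<sigma> (nhds (snd e x)) (nhds ?z0)"
    using differentiable_imp_continuous_within[OF d\<sigma>] tendsto_at_iff_tendsto_nhds[of \<sigma> ?z0]
    by (simp add: continuous_at \<sigma>0)
  with f'(1) have "\<forall>\<^sub>F z in nhds ?z0. (f \<circ> \<pi>) (chart_inv e (\<sigma> z)) \<in> fst d"
    unfolding filterlim_iff by blast
  then have "\<forall>\<^sub>F z in nhds ?z0. f (chart_inv c z) \<in> fst d"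
    using eventually_nhds_in_open[OF V] by eventually_elim (simp add: section_eq)
  ultimately show "(\<forall>\<^sub>F z in nhds ?z0. f (chart_inv c z) \<in> fst d) \<and>
      (snd d \<circ> f \<circ> chart_inv c) differentiable at ?z0"
    by blast
qed

section \<open>Translations\<close>

text \<open>Rules such as g(yH) = (gy)H hold only for y in the carrier, so the maps to be exchanged
  agree on the manifold but not on the whole type.\<close>

lemma mdifferentiable_at_cong:
  assumes M: "smooth_manifold M" and f: "mdifferentiable_at M N f p"
    and p: "p \<in> topspace (mtop M)" and eq: "\<And>q. q \<in> topspace (mtop M) \<Longrightarrow> f q = g q"
  shows "mdifferentiable_at M N g p"
  unfolding mdifferentiable_at_def
proof (intro ballI)
  fix c d assume c: "c \<in> charts_at M p" and d: "d \<in> charts_at N (g p)"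
  note c' = charts_atD[OF M c]
  have d': "d \<in> charts_at N (f p)"
    using d eq[OF p] by simp
  note f' = mdifferentiable_atD[OF f c d']
  have ev: "\<forall>\<^sub>F z in nhds (snd c p). f (chart_inv c z) = g (chart_inv c z)"
    using eventually_chart_inv[OF c'(3,2) openin_topspace p] by eventually_elim (simp add: eq)
  then have "\<forall>\<^sub>F z in nhds (snd c p). (snd d \<circ> f \<circ> chart_inv c) z = (snd d \<circ> g \<circ> chart_inv c) z"
    by eventually_elim simp
  then have "(snd d \<circ> g \<circ> chart_inv c) differentiable at (snd c p)"
    using has_derivative_transform_eventually_nhds[OF f'(2)] unfolding differentiable_def by blast
  moreover have "\<forall>\<^sub>F z in nhds (snd c p). g (chart_inv c z) \<in> fst d"
    using ev f'(1) by eventually_elim simp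
  ultimately show "(\<forall>\<^sub>F z in nhds (snd c p). g (chart_inv c z) \<in> fst d) \<and>
      (snd d \<circ> g \<circ> chart_inv c) differentiable at (snd c p)"
    by blast
qed

lemma chart_inv_product:
  assumes "is_chart S c" "is_chart T d" "p \<in> fst c" "q \<in> fst d"
  shows "chart_inv (fst c \<times> fst d, map_prod (snd c) (snd d)) (snd c p, snd d q) = (p, q)"
proof -
  have "inj_on (map_prod (snd c) (snd d)) (fst c \<times> fst d)"
    using chart_inj_on[OF assms(1)] chart_inj_on[OF assms(2)] by (rule map_prod_inj_on)
  from inv_into_f_f[OF this, of "(p, q)"] show ?thesis
    using assms by (simp add: chart_inv_def)
qed

text \<open>Left translation by g is multiplication restricted to the slice of pairs with first
  entry g. In coordinates the slice is the affine inclusion z to (\<open>snd k g\<close>, z), where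
  k is a chart at g.\<close>

lemma mdifferentiable_at_left_translation:
  assumes lie: "lie_group G GM" and g: "g \<in> carrier G" and x: "x \<in> carrier G"
  shows "mdifferentiable_at GM GM (\<lambda>h. g \<otimes>\<^bsub>G\<^esub> h) x"
  unfolding mdifferentiable_at_def
proof (intro ballI)
  let ?mult = "\<lambda>(g, h). g \<otimes>\<^bsub>G\<^esub> h"
  have GM: "smooth_manifold GM" and top: "topspace (mtop GM) = carrier G"
    and mult: "smooth_map (product_manifold GM GM) GM ?mult"
    using lie by (auto simp: lie_group_def)
  fix e d assume e: "e \<in> charts_at GM x" and d: "d \<in> charts_at GM (g \<otimes>\<^bsub>G\<^esub> x)"
  obtain k where k: "k \<in> charts_at GM g"
    using ex_charts_at[OF GM] g top by blast
  note e' = charts_atD[OF GM e] and d' = charts_atD[OF GM d] and k' = charts_atD[OF GM k]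
  \<comment> \<open>Continuity of the translation comes first: it makes \<open>?S\<close>, the
    coordinate domain of the local expression, open.\<close>
  have "continuous_map (prod_topology (mtop GM) (mtop GM)) (mtop GM) ?mult"
    using mult by (simp add: smooth_map_def product_manifold_def)
  moreover have "continuous_map (mtop GM) (prod_topology (mtop GM) (mtop GM)) (\<lambda>h. (g, h))"
    using g top by (intro continuous_map_pairedI) auto
  ultimately have "continuous_map (mtop GM) (mtop GM) (?mult \<circ> (\<lambda>h. (g, h)))"
    using continuous_map_compose by blast
  then have cont: "continuous_map (mtop GM) (mtop GM) (\<lambda>h. g \<otimes>\<^bsub>G\<^esub> h)"
    by (simp add: o_def)
  let ?S = "snd e ` {q \<in> fst e. g \<otimes>\<^bsub>G\<^esub> q \<in> fst d}"
  have S: "open ?S" "snd e x \<in> ?S"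
    using open_vimage_chart[OF e'(3) d'(3) cont] e' d' by auto
  let ?c = "(fst k \<times> fst e, map_prod (snd k) (snd e))"
  have "?c \<in> atlas (product_manifold GM GM)"
    using k'(1) e'(1) unfolding product_manifold_def manifold.select_convs by blast
  then have "smooth_on (snd ?c ` {p \<in> fst ?c. ?mult p \<in> fst d}) (snd d \<circ> ?mult \<circ> chart_inv ?c)"
    using mult d'(1) unfolding smooth_map_def by blast
  moreover have "(snd k g, snd e x) \<in> snd ?c ` {p \<in> fst ?c. ?mult p \<in> fst d}"
    using k' e' d' by (intro image_eqI[of _ _ "(g, x)"]) auto
  ultimately have "(snd d \<circ> ?mult \<circ> chart_inv ?c) differentiable at (snd k g, snd e x)"
    by (rule smooth_on_imp_differentiable)
  then have "((snd d \<circ> ?mult \<circ> chart_inv ?c) \<circ> (\<lambda>z. (snd k g, z))) differentiable at (snd e x)"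
    by (intro differentiable_chain_at) (auto simp: differentiable_def intro!: exI derivative_intros)
  then have "(snd d \<circ> (\<lambda>h. g \<otimes>\<^bsub>G\<^esub> h) \<circ> chart_inv e) differentiable at (snd e x)"
    unfolding differentiable_def
    by (elim ex_forward has_derivative_transform_within_open[OF _ S])
       (use chart_inv_apply[OF e'(3)] chart_inv_product[OF k'(3) e'(3) k'(2)] in auto)
  moreover have "\<forall>\<^sub>F z in nhds (snd e x). g \<otimes>\<^bsub>G\<^esub> chart_inv e z \<in> fst d"
    unfolding eventually_nhds using S chart_inv_apply[OF e'(3)] by (intro exI[of _ ?S]) auto
  ultimately show "(\<forall>\<^sub>F z in nhds (snd e x). g \<otimes>\<^bsub>G\<^esub> chart_inv e z \<in> fst d) \<and>
      (snd d \<circ> (\<lambda>h. g \<otimes>\<^bsub>G\<^esub> h) \<circ> chart_inv e) differentiable at (snd e x)"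
    by blast
qed

text \<open>The projection intertwines translation by g on G with translation by g on G/H. Hence the
  latter, composed with the projection, is differentiable, and descent along the projection
  applies.\<close>

lemma mdifferentiable_at_coset_translation:
  assumes lie: "lie_group G GM" and H: "subgroup H G" and M: "coset_manifold G GM H M"
    and g: "g \<in> carrier G" and p: "p \<in> topspace (mtop M)"
  shows "mdifferentiable_at M M (\<lambda>q. g <#\<^bsub>G\<^esub> q) p"
    and "g <#\<^bsub>G\<^esub> p \<in> topspace (mtop M)"
proof -
  interpret group G
    using lie by (simp add: lie_group_def)
  have GM: "smooth_manifold GM" and top: "topspace (mtop GM) = carrier G"
    using lie by (auto simp: lie_group_def)
  have smM: "smooth_manifold M" and topM: "topspace (mtop M) = lcosets\<^bsub>G\<^esub> H"
    and sub: "submersion GM M (\<lambda>x. x <#\<^bsub>G\<^esub> H)"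
    using M by (auto simp: coset_manifold_def)
  obtain x where x: "x \<in> carrier G" and p_eq: "p = x <#\<^bsub>G\<^esub> H"
    using p topM by (auto simp: LCOSETS_def)
  have assoc: "g <#\<^bsub>G\<^esub> (y <#\<^bsub>G\<^esub> H) = (g \<otimes>\<^bsub>G\<^esub> y) <#\<^bsub>G\<^esub> H" if "y \<in> carrier G" for y
    using lcos_m_assoc[OF subgroup.subset[OF H] g that] .
  show "g <#\<^bsub>G\<^esub> p \<in> topspace (mtop M)"
    unfolding topM p_eq assoc[OF x] using g x by (auto simp: LCOSETS_def)
  have "mdifferentiable_at GM M (\<lambda>x. x <#\<^bsub>G\<^esub> H) (g \<otimes>\<^bsub>G\<^esub> x)"
    using sub by (intro smooth_map_imp_mdifferentiable_at GM smM) (simp add: submersion_def)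
  then have "mdifferentiable_at GM M ((\<lambda>x. x <#\<^bsub>G\<^esub> H) \<circ> (\<lambda>h. g \<otimes>\<^bsub>G\<^esub> h)) x"
    using g x top by (intro mdifferentiable_at_compose[OF GM GM
        mdifferentiable_at_left_translation[OF lie g x]]) simp_all
  then have "mdifferentiable_at GM M ((\<lambda>q. g <#\<^bsub>G\<^esub> q) \<circ> (\<lambda>x. x <#\<^bsub>G\<^esub> H)) x"
    by (rule mdifferentiable_at_cong[OF GM]) (use x top assoc in auto)
  then show "mdifferentiable_at M M (\<lambda>q. g <#\<^bsub>G\<^esub> q) p"
    unfolding p_eq using x top by (intro mdifferentiable_at_submersion_descend[OF GM smM sub]) auto
qed

section \<open>Linear maps preserving an exponential metric\<close>

lemma tangent_linear_tzero:
  assumes "smooth_manifold M" "tangent_linear M p f"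
  shows "f tzero = 0"
proof -
  have "f (tscale 0 tzero) = 0"
    using assms tangent_space_tzero[OF assms(1), of p] unfolding tangent_linear_def by simp
  then show ?thesis
    by (simp add: tscale_def tzero_def)
qed

text \<open>The metric F gives access only to the quadratic form \<alpha>^2; polarization recovers
  the inner product.\<close>

lemma riem_form_polarization:
  assumes M: "smooth_manifold M" and a: "riemannian_metric M a" and p: "p \<in> topspace (mtop M)"
    and v: "v \<in> tangent_space M p" and w: "w \<in> tangent_space M p"
  shows "a p v w = (a p (tadd v w) (tadd v w) - a p v v - a p w w) / 2"
proof -
  have lin: "tangent_linear M p (a p u)" if "u \<in> tangent_space M p" for u
    using a p that unfolding riemannian_metric_def by blast
  have sym: "a p u u' = a p u' u" if "u \<in> tangent_space M p" "u' \<in> tangent_space M p" for u u'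
    using a p that unfolding riemannian_metric_def by blast
  have vw: "tadd v w \<in> tangent_space M p"
    using M v w by (rule tangent_space_tadd)
  have "a p (tadd v w) (tadd v w) = a p (tadd v w) v + a p (tadd v w) w"
    using lin[OF vw] v w unfolding tangent_linear_def by blast
  also have "\<dots> = a p v (tadd v w) + a p w (tadd v w)"
    using sym[OF vw v] sym[OF vw w] by simp
  also have "\<dots> = a p v v + a p v w + (a p w v + a p w w)"
    using lin[OF v] lin[OF w] v w unfolding tangent_linear_def by simp
  finally show ?thesis
    using sym[OF v w] by simp
qed

text \<open>\<alpha> is even and \<beta> is odd in the tangent vector, so the two exponential
  factors cancel. This expresses \<alpha>^2 through F alone.\<close>

lemma exponential_metric_reverse:
  assumes M: "smooth_manifold M" and F: "exponential_metric M a b F" and p: "p \<in> topspace (mtop M)"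
    and v: "v \<in> tangent_space M p"
  shows "F p v * F p (tscale (-1) v) = a p v v"
proof -
  have a: "riemannian_metric M a" and b: "tangent_linear M p (b p)"
    using F p by (auto simp: exponential_metric_def one_form_def)
  have v': "tscale (-1) v \<in> tangent_space M p"
    using M v by (rule tangent_space_tscale)
  have lin: "tangent_linear M p (a p u)" if "u \<in> tangent_space M p" for u
    using a p that unfolding riemannian_metric_def by blast
  have "a p (tscale (-1) v) (tscale (-1) v) = - a p (tscale (-1) v) v"
    using lin[OF v'] v unfolding tangent_linear_def by simp
  also have "a p (tscale (-1) v) v = a p v (tscale (-1) v)"
    using a p v v' unfolding riemannian_metric_def by blast
  also have "a p v (tscale (-1) v) = - a p v v"
    using lin[OF v] v unfolding tangent_linear_def by simp
  finally have norm: "riem_norm a p (tscale (-1) v) = riem_norm a p v"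
    by (simp add: riem_norm_def)
  have b': "b p (tscale (-1) v) = - b p v"
    using b v unfolding tangent_linear_def by simp
  \<comment> \<open>Positivity is given for nonzero vectors only. The zero vector is added here so
    that the square root squares back to \<open>a p v v\<close> in all cases.\<close>
  have "a p tzero tzero = 0"
    by (rule tangent_linear_tzero[OF M lin[OF tangent_space_tzero[OF M]]])
  then have "0 \<le> a p v v"
    using a p v unfolding riemannian_metric_def by (cases "v = tzero") (auto simp: less_imp_le)
  then have norm_sq: "riem_norm a p v * riem_norm a p v = a p v v"
    by (simp add: riem_norm_def)
  have F_eq: "F p u = riem_norm a p u * exp (b p u / riem_norm a p u)"
    if "u \<in> tangent_space M p" for u
    using F p that by (simp add: exponential_metric_def)
  \<comment> \<open>No condition on x: for the zero vector x is 0 and both sides vanish, whatever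
    the quotient in the exponent is.\<close>
  have "x * exp t * (x * exp (- t)) = x * x" for x t :: real
    by (simp add: exp_minus)
  then show ?thesis
    unfolding F_eq[OF v] F_eq[OF v'] norm b' norm_sq[symmetric] by simp
qed

text \<open>L commutes with v to -v, so it preserves F(v) F(-v), which is \<alpha>^2, and by
  polarization the inner product. With \<alpha> preserved, injectivity of exp turns equality of F
  into equality of \<beta>.\<close>

lemma
  assumes M: "smooth_manifold M" and F: "exponential_metric M a b F"
    and p: "p \<in> topspace (mtop M)" and q: "q \<in> topspace (mtop M)"
    and L: "\<And>v. v \<in> tangent_space M p \<Longrightarrow> L v \<in> tangent_space M q"
    and add: "\<And>v w. v \<in> tangent_space M p \<Longrightarrow> w \<in> tangent_space M p \<Longrightarrow> L (tadd v w) = tadd (L v) (L w)"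
    and scale: "\<And>r v. v \<in> tangent_space M p \<Longrightarrow> L (tscale r v) = tscale r (L v)"
    and isom: "\<And>v. v \<in> tangent_space M p \<Longrightarrow> F q (L v) = F p v"
    and v: "v \<in> tangent_space M p"
  shows exponential_metric_isometry_riem: "w \<in> tangent_space M p \<Longrightarrow> a q (L v) (L w) = a p v w"
    and exponential_metric_isometry_form: "b q (L v) = b p v"
proof -
  have a: "riemannian_metric M a"
    using F by (simp add: exponential_metric_def)
  have diag: "a q (L u) (L u) = a p u u" if u: "u \<in> tangent_space M p" for u
    using exponential_metric_reverse[OF M F p u] exponential_metric_reverse[OF M F q L[OF u]]
      isom[OF u] isom[OF tangent_space_tscale[OF M u]] scale[OF u] by metis
  show "a q (L v) (L w) = a p v w" if w: "w \<in> tangent_space M p"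
    using riem_form_polarization[OF M a p v w] riem_form_polarization[OF M a q L[OF v] L[OF w]]
      diag[OF v] diag[OF w] diag[OF tangent_space_tadd[OF M v w]] add[OF v w] by simp
  have exp_form: "F r u = riem_norm a r u * exp (b r u / riem_norm a r u)"
    if "r \<in> topspace (mtop M)" "u \<in> tangent_space M r" for r u
    using F that by (simp add: exponential_metric_def)
  have b: "tangent_linear M r (b r)" if "r \<in> topspace (mtop M)" for r
    using F that by (simp add: exponential_metric_def one_form_def)
  show "b q (L v) = b p v"
  \<comment> \<open>At the zero vector F vanishes and says nothing about \<beta>; there both sides
    are 0 by linearity. Elsewhere \<alpha>(v) is positive and can be cancelled.\<close>
  proof (cases "v = tzero")
    case True
    then have "L v = tzero"
      using scale[OF v, of 0] by (simp add: tscale_def tzero_def)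
    then show ?thesis
      using True tangent_linear_tzero[OF M b[OF p]] tangent_linear_tzero[OF M b[OF q]] by simp
  next
    case False
    then have pos: "riem_norm a p v > 0"
      using a p v unfolding riem_norm_def riemannian_metric_def by simp
    have "riem_norm a q (L v) = riem_norm a p v"
      using diag[OF v] by (simp add: riem_norm_def)
    then show ?thesis
      using isom[OF v] exp_form[OF p v] exp_form[OF q L[OF v]] pos by simp
  qed
qed

text \<open>Both L(X p) and X q represent the form \<beta> at q with respect to the inner product,
  and a representing vector is unique. Concretely, their difference \<open>u\<close> has inner
  product \<beta>(u) with each of them, so it is orthogonal to itself.\<close>

lemma exponential_metric_isometry_dual_vector:
  assumes M: "smooth_manifold M" and F: "exponential_metric M a b F"
    and X: "dual_vector_field M a b X"
    and p: "p \<in> topspace (mtop M)" and q: "q \<in> topspace (mtop M)"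
    and L: "\<And>v. v \<in> tangent_space M p \<Longrightarrow> L v \<in> tangent_space M q"
    and add: "\<And>v w. v \<in> tangent_space M p \<Longrightarrow> w \<in> tangent_space M p \<Longrightarrow> L (tadd v w) = tadd (L v) (L w)"
    and scale: "\<And>r v. v \<in> tangent_space M p \<Longrightarrow> L (tscale r v) = tscale r (L v)"
    and isom: "\<And>v. v \<in> tangent_space M p \<Longrightarrow> F q (L v) = F p v"
  shows "L (X p) = X q"
proof -
  have riem: "a q (L v) (L w) = a p v w" if "v \<in> tangent_space M p" "w \<in> tangent_space M p" for v w
    by (rule exponential_metric_isometry_riem[OF M F p q]) (simp_all only: L add scale isom that)
  have form: "b q (L v) = b p v" if "v \<in> tangent_space M p" for v
    by (rule exponential_metric_isometry_form[OF M F p q]) (simp_all only: L add scale isom that)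
  have a: "riemannian_metric M a"
    using F by (simp add: exponential_metric_def)
  have Xp: "X p \<in> tangent_space M p" and Xq: "X q \<in> tangent_space M q"
    using X p q by (auto simp: dual_vector_field_def vector_field_def)
  have pos: "a r u u > 0" if "r \<in> topspace (mtop M)" "u \<in> tangent_space M r" "u \<noteq> tzero" for r u
    using a that unfolding riemannian_metric_def by blast
  have lin: "tangent_linear M q (a q u)" if "u \<in> tangent_space M q" for u
    using a q that unfolding riemannian_metric_def by blast
  have zero: "a q u tzero = 0" if "u \<in> tangent_space M q" for u
    by (rule tangent_linear_tzero[OF M lin[OF that]])
  \<comment> \<open>An isometry of a positive definite form has trivial kernel, so it is onto by
    dimension. Surjectivity lets \<open>u\<close> be written as L y, where the duality of X at p can
    be applied to y.\<close>
  have surj: "L ` tangent_space M p = tangent_space M q"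
  proof (rule tangent_space_inj_imp_surj[OF M M p q L add scale])
    fix v assume v: "v \<in> tangent_space M p" and "L v = tzero"
    then have "a p v v = 0"
      using riem[OF v v] zero[OF tangent_space_tzero[OF M]] by simp
    then show "v = tzero"
      using pos[OF p v] by auto
  qed
  define u where "u = tadd (L (X p)) (tscale (-1) (X q))"
  have u: "u \<in> tangent_space M q"
    unfolding u_def by (intro tangent_space_tadd tangent_space_tscale M L Xp Xq)
  then obtain y where y: "y \<in> tangent_space M p" "u = L y"
    using surj by blast
  have "a q u (L (X p)) = b q u"
  proof -
    have "a q u (L (X p)) = a p y (X p)"
      using riem[OF y(1) Xp] y(2) by simp
    also have "\<dots> = a p (X p) y"
      using a p y Xp unfolding riemannian_metric_def by blast
    also have "\<dots> = b p y"
      using X p y by (simp add: dual_vector_field_def)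
    also have "\<dots> = b q u"
      using form[OF y(1)] y(2) by simp
    finally show ?thesis .
  qed
  moreover have "a q u (X q) = b q u"
    using a X q u Xq unfolding riemannian_metric_def dual_vector_field_def by metis
  \<comment> \<open>Only the second argument is expanded, so linearity in that argument
    suffices.\<close>
  moreover have "a q u u = a q u (L (X p)) + (-1) * a q u (X q)"
    using lin[OF u] L[OF Xp] Xq tangent_space_tscale[OF M Xq, of "-1"]
    unfolding tangent_linear_def by (subst (2) u_def) simp
  ultimately have "u = tzero"
    using pos[OF q u] by auto
  show ?thesis
  proof
    fix c
    have "u c = 0"
      using \<open>u = tzero\<close> by (simp add: tzero_def)
    then show "L (X p) c = X q c"
      by (simp add: u_def tadd_def tscale_def)
  qed
qed

section \<open>Invariance of \<alpha> and X under the group\<close>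

theorem theorem3p1:
  fixes G :: "('g, 'x) monoid_scheme"
    and GM :: "('g, 'e::euclidean_space) manifold"
    and H :: "'g set"
    and M :: "('g set, 'f::euclidean_space) manifold"
    and \<mm> :: "('g, 'e) tvec set"
    and a :: "'g set \<Rightarrow> ('g set, 'f) tvec \<Rightarrow> ('g set, 'f) tvec \<Rightarrow> real"
    and b F :: "'g set \<Rightarrow> ('g set, 'f) tvec \<Rightarrow> real"
    and X :: "'g set \<Rightarrow> ('g set, 'f) tvec"
  assumes "lie_group G GM"
    and "subgroup H G"
    and "compactin (mtop GM) H"
    and "coset_manifold G GM H M"
    and "connected_space (mtop M)"
    and "reductive_decomposition G GM H \<mm>"
    and "exponential_metric M a b F"
    and "invariant_finsler_metric G M F"
    and "dual_vector_field M a b X"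
  shows "invariant_riemannian_metric G M a \<and> invariant_vector_field G M X"
proof -
  have M: "smooth_manifold M" and vf: "vector_field M X" and riem: "riemannian_metric M a"
    using assms by (auto simp: coset_manifold_def dual_vector_field_def exponential_metric_def)
  have "(\<forall>v\<in>tangent_space M p. \<forall>w\<in>tangent_space M p.
        a (g <#\<^bsub>G\<^esub> p) (d_action G M g p v) (d_action G M g p w) = a p v w) \<and>
      d_action G M g p (X p) = X (g <#\<^bsub>G\<^esub> p)"
    if g: "g \<in> carrier G" and p: "p \<in> topspace (mtop M)" for g p
  proof -
    note diff = mdifferentiable_at_coset_translation[OF assms(1,2,4) g p]
    \<comment> \<open>The differential of the translation is a linear map between tangent spaces
      that preserves F, so the results on exponential metrics apply with it as L.\<close>
    let ?L = "d_action G M g p"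
    have L: "?L v \<in> tangent_space M (g <#\<^bsub>G\<^esub> p)" for v
      unfolding d_action_def by (rule differential_in_tangent_space[OF M M diff(1) p])
    have add: "?L (tadd v w) = tadd (?L v) (?L w)" and scale: "?L (tscale r v) = tscale r (?L v)" for v w r
      unfolding d_action_def
      by (rule differential_tadd[OF M diff(1) p] differential_tscale[OF M diff(1) p])+
    have isom: "F (g <#\<^bsub>G\<^esub> p) (?L v) = F p v" if "v \<in> tangent_space M p" for v
      using assms(8) g p that by (simp add: invariant_finsler_metric_def)
    show ?thesis
    proof (intro conjI ballI)
      show "a (g <#\<^bsub>G\<^esub> p) (?L v) (?L w) = a p v w"
        if "v \<in> tangent_space M p" "w \<in> tangent_space M p" for v w
        by (rule exponential_metric_isometry_riem[OF M assms(7) p diff(2)])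
          (simp_all only: L add scale isom that)
      show "?L (X p) = X (g <#\<^bsub>G\<^esub> p)"
        by (rule exponential_metric_isometry_dual_vector[OF M assms(7,9) p diff(2)])
          (simp_all only: L add scale isom)
    qed
  qed
  then show ?thesis
    using vf riem by (simp add: invariant_riemannian_metric_def invariant_vector_field_def)
qed

end
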